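(* For integers $n\ge 2$ let $$I(n):=\sqrt{n}\int_{0}^{\infty}\left|\frac{\sin t}{t}\right|^{n}\,dt,$$ and fix an integer $m\ge 3$. Then there exist real constants $c_3,c_4,\ldots,c_m$ (not depending on $n$) such that $$I(n)=\sqrt{\frac{3\pi}{2}}\left[1-\frac{3}{20}\,\frac{1}{n}-\frac{13}{1120}\,\frac{1}{n^{2}}+\sum_{j=3}^{m}\frac{c_j}{n^{j}}\right]+O\left(\frac{1}{n^{m+1}}\right)\qquad\text{as } n\to\infty .$$
   Context: The integrand $\frac{\sin t}{t}$ is understood to equal $1$ at $t=0$. The implied constant in the $O$-term may depend on $m$ but not on $n$. *)

theory Defs
  imports "HOL-Probability.Sinc_Integral" "HOL-Library.Landau_Symbols"
begin

text \<open>
  The library function \<^term>\<open>sinc\<close> is \<open>sin t / t\<close> with value 1 at 0. For \<open>n \<ge> 2\<close> the integrand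
  is Lebesgue integrable on \<open>[0, \<infinity>)\<close>, so that the improper integral is the Lebesgue integral;
  for \<open>n < 2\<close> it is not integrable and the value below carries no meaning.
\<close>

definition sinc_power_integral :: "nat \<Rightarrow> real" where
  "sinc_power_integral n = sqrt (real n) * (LBINT t:{0..}. \<bar>sinc t\<bar> ^ n)"

end

theory Submission
  imports Defs "HOL-Complex_Analysis.Complex_Analysis" "HOL-Real_Asymp.Real_Asymp"
begin

text \<open>
  Away from 0 the function \<open>|sinc|\<close> is bounded by some \<open>q < 1\<close>, so only an interval \<open>[0, d]\<close>
  matters. There \<open>sinc t = exp (- \<rho>(t)\<^sup>2 / 6)\<close> with \<open>\<rho>(t) = t v(t\<^sup>2)\<close> for a function \<open>v\<close> that is
  analytic at 0. Reverting the series of \<open>\<rho>\<close> gives coefficients \<open>b\<^sub>k\<close> such that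
  \<open>1 = (\<Sum>k<K. b\<^sub>k (\<rho>\<^bsup>2k+1\<^esup>)') + O(t\<^bsup>2K\<^esup>)\<close>. Multiplying by \<open>exp (- n \<rho>\<^sup>2 / 6)\<close>, integrating and
  substituting \<open>x = \<rho>(t)\<close> turns each summand into a Gaussian moment, a constant multiple of
  \<open>n\<^bsup>-k-1/2\<^esup>\<close> up to an exponentially small error.
\<close>

section \<open>Gaussian moments and Laplace expansion\<close>

lemma set_integral_subset_le:
  fixes f :: "'a \<Rightarrow> real"
  assumes "set_integrable M B f" "A \<in> sets M" "A \<subseteq> B" "\<And>x. x \<in> B \<Longrightarrow> 0 \<le> f x"
  shows "set_lebesgue_integral M A f \<le> set_lebesgue_integral M B f"
  unfolding set_lebesgue_integral_def
proof (rule integral_mono)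
  show "integrable M (\<lambda>x. indicator A x *\<^sub>R f x)" "integrable M (\<lambda>x. indicator B x *\<^sub>R f x)"
    using set_integrable_subset [OF assms(1-3)] assms(1) by (auto simp: set_integrable_def)
qed (use assms in \<open>auto simp: indicator_def\<close>)

text \<open>The integral of x^(2k) exp(-x^2) over [0, infinity), equal to Gamma(k + 1/2) /
  2.\<close>

definition half_gauss_moment :: "nat \<Rightarrow> real" where
  "half_gauss_moment k = sqrt pi / 2 * (fact (2 * k) / (2 ^ (2 * k) * fact k))"

lemma half_gauss_moment_nonneg: "half_gauss_moment k \<ge> 0"
  by (simp add: half_gauss_moment_def)

lemma has_bochner_integral_half_gauss_moment:
  assumes "a > 0"
  shows "has_bochner_integral lborel
           (\<lambda>x::real. indicator {0..} x *\<^sub>R (exp (- (a * x\<^sup>2)) * x ^ (2 * k)))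
           (half_gauss_moment k / sqrt a ^ (2 * k + 1))"
proof -
  define c where "c = 1 / sqrt a"
  have c: "c > 0" "c \<noteq> 0" and ac: "a * c\<^sup>2 = 1"
    using assms by (auto simp: c_def power_divide)
  have eq: "indicator {0..} (0 + c * x) *\<^sub>R (exp (- (a * (0 + c * x)\<^sup>2)) * (0 + c * x) ^ (2 * k))
        = c ^ (2 * k) * (indicator {0..} x *\<^sub>R (exp (- x\<^sup>2) * x ^ (2 * k)))" for x
  proof -
    have "a * (c * x)\<^sup>2 = x\<^sup>2"
      using ac by (simp add: power_mult_distrib mult.assoc [symmetric])
    moreover have "indicat_real {0..} (c * x) = indicator {0..} x"
      using c by (auto simp: indicator_def zero_le_mult_iff)
    ultimately show ?thesis by (simp add: power_mult_distrib)
  qed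
  have "half_gauss_moment k / sqrt a ^ (2 * k + 1) /\<^sub>R \<bar>c\<bar> = c ^ (2 * k) * half_gauss_moment k"
    using assms by (simp add: c_def field_simps power_divide)
  moreover have "has_bochner_integral lborel
      (\<lambda>x. c ^ (2 * k) * (indicator {0..} x *\<^sub>R (exp (- x\<^sup>2) * x ^ (2 * k))))
      (c ^ (2 * k) * half_gauss_moment k)"
    unfolding half_gauss_moment_def
    by (intro has_bochner_integral_mult_right gaussian_moment_even_pos)
  ultimately show ?thesis
    by (subst lborel_has_bochner_integral_real_affine_iff [OF c(2), where t = 0])
       (simp only: eq)
qed

lemma half_gauss_moment_set_integral:
  assumes "a > 0"
  shows "set_integrable lborel {0..} (\<lambda>x::real. exp (- (a * x\<^sup>2)) * x ^ (2 * k))"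
    and "(LBINT x:{0..}. exp (- (a * x\<^sup>2)) * x ^ (2 * k)) = half_gauss_moment k / sqrt a ^ (2 * k + 1)"
  using has_bochner_integral_half_gauss_moment [OF assms, of k]
  by (auto simp: set_integrable_def set_lebesgue_integral_def has_bochner_integral_iff)

text \<open>Of the n factors exp(-x^2/6), one is kept to make the tail integrable; beyond
  \<open>\<eta>\<close> the other n - 1 are at most exp(-(n-1) \<open>\<eta>\<close>^2/6). What
  remains is bounded by the full moment for n = 1.\<close>

lemma half_gauss_moment_tail:
  fixes \<eta> :: real and n :: nat
  assumes "\<eta> \<ge> 0" "n \<ge> 1"
  shows "\<bar>(LBINT x:{0..\<eta>}. exp (- (n / 6 * x\<^sup>2)) * x ^ (2 * k)) - half_gauss_moment k / sqrt (n / 6) ^ (2 * k + 1)\<bar>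
    \<le> exp (- ((real n - 1) / 6 * \<eta>\<^sup>2)) * (half_gauss_moment k / sqrt (1 / 6) ^ (2 * k + 1))"
proof -
  define F where "F = (\<lambda>x::real. exp (- (n / 6 * x\<^sup>2)) * x ^ (2 * k))"
  define G where "G = (\<lambda>x::real. exp (- (1 / 6 * x\<^sup>2)) * x ^ (2 * k))"
  have n: "real n / 6 > 0" using assms by simp
  have F: "set_integrable lborel {0..} F"
    and F': "(LBINT x:{0..}. F x) = half_gauss_moment k / sqrt (n / 6) ^ (2 * k + 1)"
    unfolding F_def by (rule half_gauss_moment_set_integral [OF n])+
  have G: "set_integrable lborel {0..} G"
    and G': "(LBINT x:{0..}. G x) = half_gauss_moment k / sqrt (1 / 6) ^ (2 * k + 1)"
    unfolding G_def by (rule half_gauss_moment_set_integral, simp)+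
  have F1: "set_integrable lborel {0..\<eta>} F" and F2: "set_integrable lborel {\<eta><..} F"
    using assms by (auto intro: set_integrable_subset [OF F])
  have G2: "set_integrable lborel {\<eta><..} G"
    using assms by (auto intro: set_integrable_subset [OF G])
  have "{0..} = {0..\<eta>} \<union> {\<eta><..}" using assms by auto
  then have split: "(LBINT x:{0..}. F x) = (LBINT x:{0..\<eta>}. F x) + (LBINT x:{\<eta><..}. F x)"
    using set_integral_Un [OF _ F1 F2] by (simp add: disjoint_iff)
  have le: "F x \<le> exp (- ((real n - 1) / 6 * \<eta>\<^sup>2)) * G x" if "x > \<eta>" for x
  proof -
    have "\<eta>\<^sup>2 \<le> x\<^sup>2" using that assms by (intro power_mono) auto
    then have "(real n - 1) * \<eta>\<^sup>2 \<le> (real n - 1) * x\<^sup>2"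
      using assms by (intro mult_left_mono) auto
    then have "- (n / 6 * x\<^sup>2) \<le> - ((real n - 1) / 6 * \<eta>\<^sup>2) + - (1 / 6 * x\<^sup>2)"
      by (simp add: field_simps)
    then have "exp (- (n / 6 * x\<^sup>2)) \<le> exp (- ((real n - 1) / 6 * \<eta>\<^sup>2)) * exp (- (1 / 6 * x\<^sup>2))"
      by (simp only: exp_le_cancel_iff exp_add [symmetric])
    then show ?thesis
      unfolding F_def G_def by (simp only: mult.assoc [symmetric]) (intro mult_right_mono, auto)
  qed
  have "(LBINT x:{\<eta><..}. F x) \<le> (LBINT x:{\<eta><..}. exp (- ((real n - 1) / 6 * \<eta>\<^sup>2)) * G x)"
    using F2 G2 le by (intro set_integral_mono) auto
  also have "\<dots> = exp (- ((real n - 1) / 6 * \<eta>\<^sup>2)) * (LBINT x:{\<eta><..}. G x)"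
    by (rule set_integral_mult_right)
  also have "(LBINT x:{\<eta><..}. G x) \<le> (LBINT x:{0..}. G x)"
    using assms by (intro set_integral_subset_le [OF G]) (auto simp: G_def)
  finally have "(LBINT x:{\<eta><..}. F x) \<le> exp (- ((real n - 1) / 6 * \<eta>\<^sup>2)) * (LBINT x:{0..}. G x)"
    by simp
  moreover have "0 \<le> (LBINT x:{\<eta><..}. F x)"
    unfolding set_lebesgue_integral_def by (intro integral_nonneg_AE) (auto simp: F_def)
  ultimately have "\<bar>(LBINT x:{0..\<eta>}. F x) - (LBINT x:{0..}. F x)\<bar>
      \<le> exp (- ((real n - 1) / 6 * \<eta>\<^sup>2)) * (LBINT x:{0..}. G x)"
    using split by linarith
  then show ?thesis
    unfolding F' G' by (simp only: F_def)
qed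

text \<open>The prefactor sqrt n cancels the odd square root in the moment, so the expansion runs in
  integer powers of 1/n. It is applied with \<open>a\<close> = 6 to the main terms and with
  \<open>a\<close> = 24 to the remainder.\<close>

lemma sqrt_mult_half_gauss_moment:
  assumes "n \<ge> 1"
  shows "sqrt (real n) * (half_gauss_moment k / sqrt (real n / a) ^ (2 * k + 1)) = half_gauss_moment k * sqrt a ^ (2 * k + 1) / real n ^ k"
proof -
  have "sqrt (real n) ^ (2 * k + 1) = sqrt (real n) * real n ^ k"
    by (simp add: power_mult)
  then show ?thesis
    using assms by (simp add: real_sqrt_divide power_divide field_simps del: power_Suc)
qed

lemma truncated_half_gauss_moment_bigo:
  fixes \<eta> :: real
  assumes "\<eta> > 0"
  shows "(\<lambda>n. sqrt (real n) * (LBINT x:{0..\<eta>}. exp (- (n / 6 * x\<^sup>2)) * x ^ (2 * k))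
            - half_gauss_moment k * sqrt 6 ^ (2 * k + 1) / real n ^ k) \<in> O(\<lambda>n. 1 / real n ^ K)"
proof -
  define c where "c = half_gauss_moment k / sqrt (1 / 6) ^ (2 * k + 1)"
  have c: "c \<ge> 0" by (simp add: c_def half_gauss_moment_nonneg)
  have "(\<lambda>n. sqrt (real n) * (LBINT x:{0..\<eta>}. exp (- (n / 6 * x\<^sup>2)) * x ^ (2 * k))
            - half_gauss_moment k * sqrt 6 ^ (2 * k + 1) / real n ^ k)
        \<in> O(\<lambda>n. sqrt (real n) * (exp (- ((real n - 1) / 6 * \<eta>\<^sup>2)) * c))"
  proof (intro bigoI [where c = 1] eventually_sequentiallyI [of 1])
    fix n :: nat assume n: "n \<ge> 1"
    have "sqrt (real n) * \<bar>(LBINT x:{0..\<eta>}. exp (- (n / 6 * x\<^sup>2)) * x ^ (2 * k)) - half_gauss_moment k / sqrt (n / 6) ^ (2 * k + 1)\<bar>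
       \<le> sqrt (real n) * (exp (- ((real n - 1) / 6 * \<eta>\<^sup>2)) * c)"
      unfolding c_def using half_gauss_moment_tail [OF _ n, of \<eta> k] assms by (intro mult_left_mono) auto
    also have "sqrt (real n) * \<bar>(LBINT x:{0..\<eta>}. exp (- (n / 6 * x\<^sup>2)) * x ^ (2 * k)) - half_gauss_moment k / sqrt (n / 6) ^ (2 * k + 1)\<bar>
      = \<bar>sqrt (real n) * (LBINT x:{0..\<eta>}. exp (- (n / 6 * x\<^sup>2)) * x ^ (2 * k)) - half_gauss_moment k * sqrt 6 ^ (2 * k + 1) / real n ^ k\<bar>"
      by (simp only: sqrt_mult_half_gauss_moment [OF n, of k 6, symmetric] right_diff_distrib [symmetric] abs_mult)
         simp
    finally show "norm (sqrt (real n) * (LBINT x:{0..\<eta>}. exp (- (n / 6 * x\<^sup>2)) * x ^ (2 * k))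
            - half_gauss_moment k * sqrt 6 ^ (2 * k + 1) / real n ^ k) \<le> 1 * norm (sqrt (real n) * (exp (- ((real n - 1) / 6 * \<eta>\<^sup>2)) * c))"
      using c by (simp add: abs_mult)
  qed
  also have "(\<lambda>n. sqrt (real n) * (exp (- ((real n - 1) / 6 * \<eta>\<^sup>2)) * c)) \<in> O(\<lambda>n. sqrt (real n) * exp (- ((real n - 1) / 6 * \<eta>\<^sup>2)))"
    by (simp flip: mult.assoc)
  also have "(\<lambda>n. sqrt (real n) * exp (- ((real n - 1) / 6 * \<eta>\<^sup>2))) \<in> O(\<lambda>n. 1 / real n ^ K)"
    using assms by real_asymp
  finally show ?thesis .
qed

text \<open>Since \<open>\<rho> t\<close> is at least t/2, the weight is at most exp(-n t^2/24),
  where 24 = 6 * 2^2. The integral is thus dominated by a Gaussian moment of order 2K, which has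
  size n^(-K-1/2).\<close>

lemma gaussian_remainder_bigo:
  fixes \<rho> r :: "real \<Rightarrow> real"
  assumes lower: "\<And>t. t \<in> {0..d} \<Longrightarrow> t / 2 \<le> \<rho> t"
    and bound: "\<And>t. t \<in> {0..d} \<Longrightarrow> \<bar>r t\<bar> \<le> C * t ^ (2 * K)"
    and cont: "continuous_on {0..d} \<rho>" "continuous_on {0..d} r"
  shows "(\<lambda>n. sqrt (real n) * (LBINT t:{0..d}. exp (- (n / 6 * (\<rho> t)\<^sup>2)) * r t)) \<in> O(\<lambda>n. 1 / real n ^ K)"
proof (intro bigoI [where c = "\<bar>C\<bar> * (half_gauss_moment K * sqrt 24 ^ (2 * K + 1))"] eventually_sequentiallyI [of 1])
  fix n :: nat assume n: "n \<ge> 1"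
  then have n': "real n / 24 > 0" by simp
  let ?G = "\<lambda>x::real. exp (- (n / 24 * x\<^sup>2)) * x ^ (2 * K)"
  note G = half_gauss_moment_set_integral [OF n', of K]
  have G1: "set_integrable lborel {0..d} ?G"
    by (rule set_integrable_subset [OF G(1)]) auto
  have le: "\<bar>exp (- (n / 6 * (\<rho> t)\<^sup>2)) * r t\<bar> \<le> \<bar>C\<bar> * ?G t" if t: "t \<in> {0..d}" for t
  proof -
    have "(t / 2)\<^sup>2 \<le> (\<rho> t)\<^sup>2" using t lower [OF t] by (intro power_mono) auto
    then have "n * (t / 2)\<^sup>2 \<le> n * (\<rho> t)\<^sup>2" by (intro mult_left_mono) auto
    then have e: "exp (- (n / 6 * (\<rho> t)\<^sup>2)) \<le> exp (- (n / 24 * t\<^sup>2))"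
      by (simp add: power_divide field_simps)
    have "\<bar>r t\<bar> \<le> \<bar>C\<bar> * t ^ (2 * K)"
      using bound [OF t] t by (smt (verit) mult_right_mono zero_le_power atLeastAtMost_iff)
    with e have "exp (- (n / 6 * (\<rho> t)\<^sup>2)) * \<bar>r t\<bar> \<le> exp (- (n / 24 * t\<^sup>2)) * (\<bar>C\<bar> * t ^ (2 * K))"
      by (intro mult_mono) auto
    then show ?thesis by (simp add: abs_mult mult_ac)
  qed
  have F: "set_integrable lborel {0..d} (\<lambda>t. exp (- (n / 6 * (\<rho> t)\<^sup>2)) * r t)"
    by (intro borel_integrable_atLeastAtMost' continuous_intros cont)
  have "\<bar>LBINT t:{0..d}. exp (- (n / 6 * (\<rho> t)\<^sup>2)) * r t\<bar> \<le> (LBINT t:{0..d}. \<bar>exp (- (n / 6 * (\<rho> t)\<^sup>2)) * r t\<bar>)"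
    using set_integral_norm_bound [OF F] by simp
  also have "\<dots> \<le> (LBINT t:{0..d}. \<bar>C\<bar> * ?G t)"
    using le F G1 by (intro set_integral_mono set_integrable_abs set_integrable_mult_right) auto
  also have "\<dots> = \<bar>C\<bar> * (LBINT t:{0..d}. ?G t)"
    by (rule set_integral_mult_right)
  also have "\<dots> \<le> \<bar>C\<bar> * (LBINT t:{0..}. ?G t)"
    by (intro mult_left_mono set_integral_subset_le [OF G(1)]) auto
  also have "\<dots> = \<bar>C\<bar> * (half_gauss_moment K / sqrt (n / 24) ^ (2 * K + 1))"
    by (subst G(2)) simp
  finally have "sqrt (real n) * \<bar>LBINT t:{0..d}. exp (- (n / 6 * (\<rho> t)\<^sup>2)) * r t\<bar>
     \<le> sqrt (real n) * (\<bar>C\<bar> * (half_gauss_moment K / sqrt (n / 24) ^ (2 * K + 1)))"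
    by (intro mult_left_mono) auto
  also have "\<dots> = \<bar>C\<bar> * (sqrt (real n) * (half_gauss_moment K / sqrt (n / 24) ^ (2 * K + 1)))"
    by simp
  also have "\<dots> = \<bar>C\<bar> * (half_gauss_moment K * sqrt 24 ^ (2 * K + 1) / real n ^ K)"
    by (simp only: sqrt_mult_half_gauss_moment [OF n])
  finally show "norm (sqrt (real n) * (LBINT t:{0..d}. exp (- (n / 6 * (\<rho> t)\<^sup>2)) * r t))
      \<le> \<bar>C\<bar> * (half_gauss_moment K * sqrt 24 ^ (2 * K + 1)) * norm (1 / real n ^ K)"
    by (simp add: abs_mult)
qed

text \<open>The assumption \<open>bound\<close> writes 1 as a combination of derivatives of odd
  powers of \<open>\<rho>\<close>, up to O(t^(2K)). After multiplication by the weight, each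
  derivative becomes a truncated Gaussian moment under x = \<open>\<rho> t\<close>, and the rest is
  controlled by \<open>gaussian_remainder_bigo\<close>.\<close>

lemma laplace_expansion:
  fixes \<rho> \<rho>' :: "real \<Rightarrow> real"
  assumes d: "d > 0" and \<rho>0: "\<rho> 0 = 0"
    and deriv: "\<And>t. t \<in> {0..d} \<Longrightarrow> (\<rho> has_real_derivative \<rho>' t) (at t)"
    and cont: "continuous_on {0..d} \<rho>'"
    and nonneg: "\<And>t. t \<in> {0..d} \<Longrightarrow> \<rho>' t \<ge> 0"
    and lower: "\<And>t. t \<in> {0..d} \<Longrightarrow> t / 2 \<le> \<rho> t"
    and bound: "\<And>t. t \<in> {0..d} \<Longrightarrow>
       \<bar>1 - (\<Sum>k<K. b k * (real (2 * k + 1) * \<rho> t ^ (2 * k) * \<rho>' t))\<bar> \<le> C * t ^ (2 * K)"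
  shows "(\<lambda>n. sqrt (real n) * (LBINT t:{0..d}. exp (- (n / 6 * (\<rho> t)\<^sup>2)))
     - (\<Sum>k<K. b k * real (2 * k + 1) * half_gauss_moment k * sqrt 6 ^ (2 * k + 1) / real n ^ k))
       \<in> O(\<lambda>n. 1 / real n ^ K)"
proof -
  define r where "r = (\<lambda>t. 1 - (\<Sum>k<K. b k * (real (2 * k + 1) * \<rho> t ^ (2 * k) * \<rho>' t)))"
  define F where "F = (\<lambda>(n::nat) t. exp (- (n / 6 * (\<rho> t)\<^sup>2)))"
  define J where "J = (\<lambda>(n::nat) k. LBINT x:{0..\<rho> d}. exp (- (n / 6 * x\<^sup>2)) * x ^ (2 * k))"
  have \<rho>d: "\<rho> d > 0" using lower [of d] d by auto
  have cont\<rho>: "continuous_on {0..d} \<rho>"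
    using deriv by (rule has_real_derivative_imp_continuous_on)
  have contr: "continuous_on {0..d} r"
    unfolding r_def by (intro continuous_intros cont cont\<rho>)
  have subst: "(LBINT t:{0..d}. F n t * \<rho> t ^ (2 * k) * \<rho>' t) = J n k" for n k
  proof -
    have "set_integrable lborel {\<rho> 0..\<rho> d} (\<lambda>x. exp (- (n / 6 * x\<^sup>2)) * x ^ (2 * k))"
      by (intro borel_integrable_atLeastAtMost' continuous_intros)
    from integral_substitution(2) [OF this deriv cont nonneg] d show ?thesis
      by (simp add: J_def F_def \<rho>0 set_lebesgue_integral_def mult_ac)
  qed
  have eq: "sqrt (real n) * (LBINT t:{0..d}. F n t)
     - (\<Sum>k<K. b k * real (2 * k + 1) * half_gauss_moment k * sqrt 6 ^ (2 * k + 1) / real n ^ k)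
     = sqrt (real n) * (LBINT t:{0..d}. F n t * r t) + (\<Sum>k<K. b k * real (2 * k + 1) *
          (sqrt (real n) * J n k - half_gauss_moment k * sqrt 6 ^ (2 * k + 1) / real n ^ k))" for n
  proof -
    let ?g = "\<lambda>k t. b k * real (2 * k + 1) * (F n t * \<rho> t ^ (2 * k) * \<rho>' t)"
    have Fr: "set_integrable lborel {0..d} (\<lambda>t. F n t * r t)"
      unfolding F_def by (intro borel_integrable_atLeastAtMost' continuous_intros contr cont\<rho>)
    have G: "set_integrable lborel {0..d} (?g k)" for k
      unfolding F_def by (intro borel_integrable_atLeastAtMost' continuous_intros cont cont\<rho>)
    have S: "set_integrable lborel {0..d} (\<lambda>t. \<Sum>k<K. ?g k t)"
      unfolding F_def by (intro borel_integrable_atLeastAtMost' continuous_intros cont cont\<rho>)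
    have "F n t = F n t * r t + (\<Sum>k<K. ?g k t)" for t
      by (simp add: r_def right_diff_distrib sum_distrib_left mult_ac)
    then have "(LBINT t:{0..d}. F n t) = (LBINT t:{0..d}. F n t * r t + (\<Sum>k<K. ?g k t))"
      by simp
    also have "\<dots> = (LBINT t:{0..d}. F n t * r t) + (LBINT t:{0..d}. (\<Sum>k<K. ?g k t))"
      by (rule set_integral_add(2) [OF Fr S])
    also have "(LBINT t:{0..d}. (\<Sum>k<K. ?g k t)) = (\<Sum>k<K. LBINT t:{0..d}. ?g k t)"
      using G unfolding set_lebesgue_integral_def set_integrable_def scaleR_sum_right
      by (intro Bochner_Integration.integral_sum) auto
    also have "\<dots> = (\<Sum>k<K. b k * real (2 * k + 1) * J n k)"
      by (simp only: set_integral_mult_right subst)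
    finally show ?thesis
      by (simp add: ring_distribs sum_subtractf sum_distrib_left mult_ac)
  qed
  \<comment> \<open>The case c = 0 has to be covered because a coefficient \<open>b k\<close> may
    vanish.\<close>
  have cmult: "(\<lambda>n. c * f n) \<in> O(g)" if "f \<in> O(g)" for c :: real and f g :: "nat \<Rightarrow> real"
    using that by (cases "c = 0") auto
  have "(\<lambda>n. \<Sum>k<K. b k * real (2 * k + 1) *
          (sqrt (real n) * J n k - half_gauss_moment k * sqrt 6 ^ (2 * k + 1) / real n ^ k)) \<in> O(\<lambda>n. 1 / real n ^ K)"
    unfolding J_def
    by (intro big_sum_in_bigo cmult truncated_half_gauss_moment_bigo \<rho>d)
  moreover have "(\<lambda>n. sqrt (real n) * (LBINT t:{0..d}. F n t * r t)) \<in> O(\<lambda>n. 1 / real n ^ K)"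
    unfolding F_def using bound by (intro gaussian_remainder_bigo [of d \<rho> r C] lower cont\<rho> contr) (auto simp: r_def)
  ultimately have "(\<lambda>n. sqrt (real n) * (LBINT t:{0..d}. F n t)
     - (\<Sum>k<K. b k * real (2 * k + 1) * half_gauss_moment k * sqrt 6 ^ (2 * k + 1) / real n ^ k))
       \<in> O(\<lambda>n. 1 / real n ^ K)"
    unfolding eq by (intro sum_in_bigo)
  then show ?thesis
    by (simp only: F_def)
qed

section \<open>The substitution turning sinc into a Gaussian\<close>

text \<open>The series of sin(sqrt w) / sqrt w. The variable w = t^2 absorbs the evenness of sinc,
  and complex coefficients make analyticity available for the logarithm and the square root taken
  below.\<close>

definition sinc_sqrt_fps :: "complex fps" where
  "sinc_sqrt_fps = Abs_fps (\<lambda>n. (- 1) ^ n / fact (2 * n + 1))"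

lemma fps_conv_radius_sinc_sqrt_fps [simp]: "fps_conv_radius sinc_sqrt_fps = \<infinity>"
  unfolding fps_conv_radius_def
proof (rule conv_radius_inftyI'')
  fix z :: complex
  have "norm (fps_nth sinc_sqrt_fps n * z ^ n) \<le> inverse (fact n) * norm z ^ n" for n
  proof -
    have "fact n \<le> (fact (2 * n + 1) :: real)" by (intro fact_mono) auto
    then have "1 / fact (2 * n + 1) \<le> 1 / (fact n :: real)" by (simp add: frac_le)
    then show ?thesis
      by (simp only: sinc_sqrt_fps_def fps_nth_Abs_fps norm_mult norm_power norm_divide norm_fact)
         (auto simp: divide_inverse intro!: mult_right_mono simp del: fact_Suc)
  qed
  then show "summable (\<lambda>n. fps_nth sinc_sqrt_fps n * z ^ n)"
    by (intro summable_comparison_test' [OF summable_exp [of "norm z"]]) auto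
qed

lemma eval_sinc_sqrt_fps: "eval_fps sinc_sqrt_fps (of_real (t\<^sup>2)) = of_real (sinc t)"
proof (cases "t = 0")
  case True
  then show ?thesis by (simp add: eval_fps_at_0 sinc_sqrt_fps_def)
next
  case False
  have "(\<lambda>n. (- 1) ^ n / fact (2 * n + 1) * t ^ (2 * n + 1) / t) sums (sin t / t)"
    by (intro sums_divide sin_paired)
  also have "(\<lambda>n. (- 1) ^ n / fact (2 * n + 1) * t ^ (2 * n + 1) / t) = (\<lambda>n. (- 1) ^ n / fact (2 * n + 1) * (t\<^sup>2) ^ n)"
    using False by (simp add: power_mult)
  finally have "(\<lambda>n. complex_of_real ((- 1) ^ n / fact (2 * n + 1) * (t\<^sup>2) ^ n)) sums of_real (sin t / t)"
    by (rule sums_of_real)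
  then have "(\<lambda>n. fps_nth sinc_sqrt_fps n * of_real (t\<^sup>2) ^ n) sums of_real (sin t / t)"
    by (simp add: sinc_sqrt_fps_def del: fact_Suc)
  then show ?thesis
    using False by (simp add: eval_fps_def sums_iff)
qed

text \<open>Solving exp(-w v^2/6) = sinc(sqrt w) gives v^2 = -6 log(sinc(sqrt w)) / w. The logarithm
  begins with -w/6, so this quotient is analytic at 0 with value 1 and has an analytic principal
  square root there. Reality of \<open>v\<close> at w = t^2 is recorded so that t v(t^2) can serve
  as a real substitution.\<close>

lemma sinc_substitution_factor:
  obtains v V where
    "v has_fps_expansion V" "fps_nth V 0 = 1" "fps_nth V 1 = 1 / 60" "fps_nth V 2 = 1 / 945 - 1 / 7200"
    "\<forall>\<^sub>F w in nhds 0. exp (- (w * v w ^ 2) / 6) = eval_fps sinc_sqrt_fps w"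
    "\<forall>\<^sub>F w in nhds 0. \<forall>t::real. w = of_real (t\<^sup>2) \<longrightarrow> v w \<in> \<real>"
proof -
  define \<sigma> where "\<sigma> = eval_fps sinc_sqrt_fps"
  define L where "L = (\<lambda>w. Ln (\<sigma> w))"
  have \<sigma>: "\<sigma> has_fps_expansion sinc_sqrt_fps"
    unfolding \<sigma>_def by (rule eval_fps_has_fps_expansion) simp
  have S: "fps_nth sinc_sqrt_fps 0 = 1" "fps_nth sinc_sqrt_fps (Suc 0) = - 1 / 6"
    "fps_nth sinc_sqrt_fps 2 = 1 / 120" "fps_nth sinc_sqrt_fps 3 = - 1 / 5040"
    by (simp_all add: sinc_sqrt_fps_def fact_numeral eval_nat_numeral)
  have \<sigma>0: "\<sigma> 0 = 1" by (simp add: \<sigma>_def eval_fps_at_0 S)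
  have "open (- \<real>\<^sub>\<le>\<^sub>0 :: complex set)"
    by (simp add: open_Compl)
  moreover have \<sigma>_tendsto: "(\<sigma> \<longlongrightarrow> 1) (nhds 0)"
    using has_fps_expansion_imp_continuous [OF \<sigma>, of UNIV] \<sigma>0
    by (simp add: continuous_within tendsto_nhds_iff)
  ultimately have ev_slit: "\<forall>\<^sub>F w in nhds 0. \<sigma> w \<in> - \<real>\<^sub>\<le>\<^sub>0"
    using topological_tendstoD [of \<sigma> 1 "nhds 0" "- \<real>\<^sub>\<le>\<^sub>0"] by simp
  have "L analytic_on {0}"
    unfolding L_def by (intro analytic_intros has_fps_expansion_imp_analytic_0 [OF \<sigma>]) (auto simp: \<sigma>0)
  then obtain \<Lambda> where \<Lambda>: "L has_fps_expansion \<Lambda>"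
    using analytic_at_imp_has_fps_expansion_0 by blast
  have L0: "L 0 = 0" by (simp add: L_def \<sigma>0)
  then have \<Lambda>0: "fps_nth \<Lambda> 0 = 0" using fps_nth_fps_expansion [OF \<Lambda>, of 0] by simp
  \<comment> \<open>The equation L' * sigma = sigma' determines the coefficients of the logarithm
    recursively; its coefficients 0, 1 and 2 yield those of w, w^2 and w^3.\<close>
  have "fps_deriv \<Lambda> * sinc_sqrt_fps = fps_deriv sinc_sqrt_fps"
  proof (rule fps_expansion_unique_complex)
    show "(\<lambda>w. deriv L w * \<sigma> w) has_fps_expansion fps_deriv \<Lambda> * sinc_sqrt_fps"
      by (intro fps_expansion_intros \<Lambda> \<sigma>)
    have "\<forall>\<^sub>F w in nhds 0. deriv \<sigma> w = deriv L w * \<sigma> w"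
      using ev_slit
    proof eventually_elim
      case (elim w)
      have \<sigma>': "(\<sigma> has_field_derivative deriv \<sigma> w) (at w)"
        unfolding DERIV_deriv_iff_field_differentiable \<sigma>_def
        by (rule analytic_on_imp_differentiable_at [of _ UNIV]) (auto intro!: analytic_on_eval_fps)
      have "(L has_field_derivative inverse (\<sigma> w) * deriv \<sigma> w) (at w)"
        unfolding L_def using elim by (intro DERIV_chain2 [OF has_field_derivative_Ln \<sigma>']) auto
      then have "deriv L w = inverse (\<sigma> w) * deriv \<sigma> w" by (rule DERIV_imp_deriv)
      moreover have "\<sigma> w \<noteq> 0" using elim by auto
      ultimately show ?case by (simp add: field_simps)
    qed
    then show "(\<lambda>w. deriv L w * \<sigma> w) has_fps_expansion fps_deriv sinc_sqrt_fps"
      using has_fps_expansion_deriv [OF \<sigma>] by (simp only: has_fps_expansion_cong)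
  qed
  then have *: "fps_nth (fps_deriv \<Lambda> * sinc_sqrt_fps) n = fps_nth (fps_deriv sinc_sqrt_fps) n" for n
    by simp
  have \<Lambda>1: "fps_nth \<Lambda> 1 = - 1 / 6"
    using * [of 0] by (simp add: S)
  have \<Lambda>2: "fps_nth \<Lambda> 2 = - 1 / 180"
  proof -
    have "(- 1 / 6) * (- 1 / 6) + 2 * fps_nth \<Lambda> 2 = 1 / 60"
      using * [of 1] \<Lambda>1 by (simp add: fps_mult_nth_1 S add.commute flip: numeral_2_eq_2)
    then show ?thesis by (simp add: complex_eq_iff)
  qed
  have \<Lambda>3: "fps_nth \<Lambda> 3 = - 1 / 2835"
  proof -
    have "3 * fps_nth \<Lambda> 3 + (1 / 540 - 1 / 120 / 6) = 3 * (- 1 / 5040)"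
      using * [of 2] \<Lambda>1 \<Lambda>2
      by (simp add: fps_mult_nth atLeast0_atMost_Suc eval_nat_numeral
          S(1,2) S(3) [unfolded numeral_2_eq_2] S(4) [unfolded numeral_3_eq_3])
    then show ?thesis by (simp add: complex_eq_iff)
  qed
  \<comment> \<open>The value 1 at 0 is the limit, -6 * (-1/6). The exponent 1 matches the shift by
    one in the power series.\<close>
  define q where "q = (\<lambda>w. if w = 0 then 1 else - 6 * L w / w ^ 1)"
  have q: "q has_fps_expansion fps_shift 1 (fps_const (- 6) * \<Lambda>)"
    unfolding q_def using \<Lambda>0 \<Lambda>1
    by (intro has_fps_expansion_shift has_fps_expansion_cmult_left \<Lambda>)
       (auto intro!: subdegree_geI dest!: arg_cong [of _ _ "\<lambda>f. fps_nth f 1"])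
  define v where "v = (\<lambda>w. csqrt (q w))"
  have "v analytic_on {0}"
    unfolding v_def
    by (intro analytic_intros has_fps_expansion_imp_analytic_0 [OF q]) (auto simp: q_def)
  then obtain V where V: "v has_fps_expansion V"
    using analytic_at_imp_has_fps_expansion_0 by blast
  have "(\<lambda>w. v w ^ 2) has_fps_expansion V ^ 2"
    by (intro fps_expansion_intros V)
  then have "q has_fps_expansion V ^ 2"
    by (simp add: v_def)
  \<comment> \<open>Both sides expand \<open>q\<close>, which is 1 + w/30 + 2 w^2/945 + ..., so the
    coefficients of its root follow by comparison.\<close>
  with q have V2: "V ^ 2 = fps_shift 1 (fps_const (- 6) * \<Lambda>)"
    using fps_expansion_unique_complex by blast
  have V_0: "fps_nth V 0 = 1"
    using fps_nth_fps_expansion [OF V, of 0] by (simp add: v_def q_def)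
  have V_1: "fps_nth V 1 = 1 / 60"
  proof -
    have "2 * fps_nth V 1 = 1 / 30"
      using arg_cong [OF V2, of "\<lambda>f. fps_nth f 1"] V_0 \<Lambda>2
      by (simp add: power2_eq_square fps_mult_nth_1 flip: numeral_2_eq_2)
    then show ?thesis by (simp add: complex_eq_iff)
  qed
  have V_2: "fps_nth V 2 = 1 / 945 - 1 / 7200"
  proof -
    have "2 * fps_nth V 2 + (1 / 60) * (1 / 60) = 2 / 945"
      using arg_cong [OF V2, of "\<lambda>f. fps_nth f 2"] V_0 \<Lambda>3
      by (simp add: power2_eq_square fps_mult_nth atLeast0_atMost_Suc eval_nat_numeral
          V_1 [unfolded One_nat_def])
    then show ?thesis by (simp add: complex_eq_iff)
  qed
  have exp: "\<forall>\<^sub>F w in nhds 0. exp (- (w * v w ^ 2) / 6) = \<sigma> w"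
    using ev_slit
  proof eventually_elim
    case (elim w)
    then have "\<sigma> w \<noteq> 0" by auto
    then show ?case by (cases "w = 0") (auto simp: v_def q_def L_def \<sigma>0)
  qed
  \<comment> \<open>A real value of \<open>q\<close> alone would allow an imaginary root; positivity
    of its real part excludes this. That \<open>q\<close> is real at w = t^2 follows since sinc t is
    real and off the slit, hence positive.\<close>
  have "(q \<longlongrightarrow> 1) (nhds 0)"
    using has_fps_expansion_imp_continuous [OF q, of UNIV]
    by (simp add: continuous_within tendsto_nhds_iff q_def)
  then have "((\<lambda>w. Re (q w)) \<longlongrightarrow> Re 1) (nhds 0)" by (rule tendsto_Re)
  then have "\<forall>\<^sub>F w in nhds 0. Re (q w) > 0" by (rule order_tendstoD) simp
  then have real: "\<forall>\<^sub>F w in nhds 0. \<forall>t::real. w = of_real (t\<^sup>2) \<longrightarrow> v w \<in> \<real>"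
    using ev_slit
  proof (eventually_elim, intro allI impI)
    fix w t assume q: "0 < Re (q w)" and w: "\<sigma> w \<in> - \<real>\<^sub>\<le>\<^sub>0" "w = complex_of_real (t\<^sup>2)"
    then have "\<sigma> w = of_real (sinc t)" unfolding \<sigma>_def by (simp only: eval_sinc_sqrt_fps)
    with w have "L w = of_real (ln (sinc t))"
      unfolding L_def by (subst Ln_of_real [symmetric]) (auto simp del: of_real_power)
    then have "q w \<in> \<real>" unfolding q_def w by auto
    then obtain x where "q w = of_real x" by (auto elim: Reals_cases)
    with q show "v w \<in> \<real>" by (simp add: v_def flip: of_real_sqrt)
  qed
  show ?thesis
    using that [OF V V_0 V_1 V_2 exp [unfolded \<sigma>_def] real] .
qed

section \<open>Reversion of an odd power series\<close>

text \<open>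
  With \<open>b\<^sub>k\<close> the constant coefficient of the \<open>k\<close>-th remainder, \<open>t = (\<Sum>k. b\<^sub>k (t V(t\<^sup>2))\<^bsup>2k+1\<^esup>)\<close>
  inverts the odd series \<open>t V(t\<^sup>2)\<close>; the recursion is this identity, divided by \<open>t\<close> and written
  in \<open>w = t\<^sup>2\<close>.
\<close>

primrec reversion_remainder :: "'a :: field fps \<Rightarrow> nat \<Rightarrow> 'a fps" where
  "reversion_remainder V 0 = 1"
| "reversion_remainder V (Suc k) =
     fps_shift 1 (reversion_remainder V k - fps_const (fps_nth (reversion_remainder V k) 0) * V ^ (2 * k + 1))"

text \<open>Because V has constant coefficient 1, subtracting the multiple of V^(2K+1) cancels the
  constant coefficient of the remainder. The difference is therefore divisible by X, and the shift
  loses nothing.\<close>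

lemma reversion_remainder_eq:
  assumes "fps_nth V 0 = 1"
  shows "(\<Sum>k<K. fps_const (fps_nth (reversion_remainder V k) 0) * (fps_X ^ k * V ^ (2 * k + 1)))
      + fps_X ^ K * reversion_remainder V K = 1"
proof (induction K)
  case (Suc K)
  let ?E = "reversion_remainder V K - fps_const (fps_nth (reversion_remainder V K) 0) * V ^ (2 * K + 1)"
  have "fps_nth ?E 0 = 0"
    using assms by (simp add: fps_nth_power_0)
  then have "fps_X * fps_shift 1 ?E = ?E"
    by (intro fps_ext) (auto simp: fps_X_mult_nth)
  then have "fps_X ^ Suc K * reversion_remainder V (Suc K) = fps_X ^ K * ?E"
    by (simp only: reversion_remainder.simps power_Suc2 mult.assoc)
  also have "\<dots> = fps_X ^ K * reversion_remainder V K
      - fps_const (fps_nth (reversion_remainder V K) 0) * (fps_X ^ K * V ^ (2 * K + 1))"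
    by (simp only: right_diff_distrib mult.left_commute)
  finally show ?case
    using Suc by (simp only: sum.lessThan_Suc) simp
qed simp

text \<open>Powers, scalar multiples, differences and shifts do not shrink the radius. Hence each
  remainder sums to an analytic function, bounded near 0, when V has positive radius.\<close>

lemma fps_conv_radius_reversion_remainder:
  fixes V :: "'a :: {banach, real_normed_field} fps"
  shows "fps_conv_radius V \<le> fps_conv_radius (reversion_remainder V k)"
proof (induction k)
  case (Suc k)
  let ?c = "fps_const (fps_nth (reversion_remainder V k) 0)"
  have "fps_conv_radius V \<le> fps_conv_radius (?c * V ^ (2 * k + 1))"
    using fps_conv_radius_mult [of ?c "V ^ (2 * k + 1)"] fps_conv_radius_power [of V "2 * k + 1"]
    by (auto intro: order_trans)
  then show ?case
    using Suc fps_conv_radius_diff [of "reversion_remainder V k" "?c * V ^ (2 * k + 1)"]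
    by (simp only: reversion_remainder.simps fps_conv_radius_shift) (meson min.boundedI order_trans)
qed simp

lemma reversion_remainder_0:
  assumes "fps_nth V 0 = 1"
  shows "fps_nth (reversion_remainder V 0) 0 = 1"
    "fps_nth (reversion_remainder V 1) 0 = - fps_nth V 1"
    "fps_nth (reversion_remainder V 2) 0 = 3 * fps_nth V 1 ^ 2 - fps_nth V 2"
  using assms
  by (simp_all add: numeral_2_eq_2 numeral_3_eq_3 power2_eq_square fps_mult_nth_1 fps_nth_power_0 algebra_simps)

text \<open>Reversion gives t - (sum of \<open>b k\<close> * \<open>\<rho> t\<close>^(2k+1) for k <
  K) = t^(2K+1) e(t^2) with \<open>e\<close> analytic at 0. Differentiating yields the required
  remainder t^(2K) h(t) with \<open>h\<close> bounded. The argument is carried out for complex z and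
  then restricted to a real interval.\<close>

lemma sinc_substitution:
  obtains d :: real and \<rho> \<rho>' :: "real \<Rightarrow> real" and b :: "nat \<Rightarrow> real" and C :: real where
    "d > 0" "\<rho> 0 = 0"
    "\<And>t. t \<in> {0..d} \<Longrightarrow> (\<rho> has_real_derivative \<rho>' t) (at t)"
    "continuous_on {0..d} \<rho>'"
    "\<And>t. t \<in> {0..d} \<Longrightarrow> \<rho>' t \<ge> 0"
    "\<And>t. t \<in> {0..d} \<Longrightarrow> t / 2 \<le> \<rho> t"
    "\<And>t. t \<in> {0..d} \<Longrightarrow>
       \<bar>1 - (\<Sum>k<K. b k * (real (2 * k + 1) * \<rho> t ^ (2 * k) * \<rho>' t))\<bar> \<le> C * t ^ (2 * K)"
    "\<And>t. t \<in> {0..d} \<Longrightarrow> sinc t = exp (- (\<rho> t)\<^sup>2 / 6)"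
    "b 0 = 1" "b 1 = - 1 / 60" "b 2 = - 13 / 151200"
proof -
  obtain v V where V: "v has_fps_expansion V" "fps_nth V 0 = 1" "fps_nth V 1 = 1 / 60"
      "fps_nth V 2 = 1 / 945 - 1 / 7200"
    and ev_exp: "\<forall>\<^sub>F w in nhds 0. exp (- (w * v w ^ 2) / 6) = eval_fps sinc_sqrt_fps w"
    and ev_real: "\<forall>\<^sub>F w in nhds 0. \<forall>t::real. w = of_real (t\<^sup>2) \<longrightarrow> v w \<in> \<real>"
    by (fact sinc_substitution_factor)
  define \<beta> where "\<beta> = (\<lambda>k. fps_nth (reversion_remainder V k) 0)"
  define e where "e = eval_fps (reversion_remainder V K)"
  have e: "e has_fps_expansion reversion_remainder V K"
    unfolding e_def
    using V(1) fps_conv_radius_reversion_remainder [of V K]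
    by (intro eval_fps_has_fps_expansion) (auto simp: has_fps_expansion_def)
  have ev_id: "\<forall>\<^sub>F w in nhds 0. (\<Sum>k<K. \<beta> k * (w ^ k * v w ^ (2 * k + 1))) + w ^ K * e w = 1"
  proof -
    have "(\<lambda>w. (\<Sum>k<K. \<beta> k * (w ^ k * v w ^ (2 * k + 1))) + w ^ K * e w) has_fps_expansion
      (\<Sum>k<K. fps_const (\<beta> k) * (fps_X ^ k * V ^ (2 * k + 1))) + fps_X ^ K * reversion_remainder V K"
      by (intro fps_expansion_intros V(1) e)
    also have "\<dots> = 1"
      unfolding \<beta>_def by (rule reversion_remainder_eq [OF V(2)])
    finally have "\<forall>\<^sub>F w in nhds 0. eval_fps 1 w = (\<Sum>k<K. \<beta> k * (w ^ k * v w ^ (2 * k + 1))) + w ^ K * e w"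
      unfolding has_fps_expansion_def by (rule conjunct2)
    then show ?thesis
      by eventually_elim (simp only: eval_fps_1)
  qed
  obtain A where A: "open A" "0 \<in> A" "v holomorphic_on A"
    using has_fps_expansion_imp_holomorphic [OF V(1)] by blast
  obtain B where B: "open B" "0 \<in> B" "e holomorphic_on B"
    using has_fps_expansion_imp_holomorphic [OF e] by blast
  have v0: "v 0 = 1" using fps_nth_fps_expansion [OF V(1), of 0] V(2) by simp
  \<comment> \<open>\<open>r\<close> is the complex version of \<open>\<rho>\<close> and
    \<open>r'\<close> its derivative; z^(2K) h(z) is the derivative of z^(2K+1) e(z^2).\<close>
  define r where "r = (\<lambda>z. z * v (z\<^sup>2))"
  define r' where "r' = (\<lambda>z. v (z\<^sup>2) + z * (deriv v (z\<^sup>2) * (2 * z)))"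
  define h where "h = (\<lambda>z. of_nat (2 * K + 1) * e (z\<^sup>2) + z * (deriv e (z\<^sup>2) * (2 * z)))"
  have sq: "((\<lambda>z::complex. z\<^sup>2) \<longlongrightarrow> 0) (nhds 0)"
    by (rule tendsto_eq_intros tendsto_ident_at refl filterlim_ident)+ simp
  \<comment> \<open>Transfers what holds for w near 0 to w = z^2 with z near 0.\<close>
  note ev_sq = eventually_compose_filterlim [OF _ sq]
  have contv: "continuous_on A v" "continuous_on A (deriv v)"
    and conte: "continuous_on B e" "continuous_on B (deriv e)"
    using A B by (auto intro!: holomorphic_on_imp_continuous_on holomorphic_deriv)
  have isCont_sq: "isCont (\<lambda>z. f (z\<^sup>2)) 0" if "continuous_on X f" "open X" "0 \<in> X"
    for f :: "complex \<Rightarrow> complex" and X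
  proof (rule isCont_o2 [where g = f])
    show "isCont f (0\<^sup>2)" using that by (simp add: continuous_on_eq_continuous_at)
  qed auto
  note v_sq = isCont_sq [OF contv(1) A(1,2)] isCont_sq [OF contv(2) A(1,2)]
  note e_sq = isCont_sq [OF conte(1) B(1,2)] isCont_sq [OF conte(2) B(1,2)]
  have nhds: "(f \<longlongrightarrow> f 0) (nhds 0)" if "isCont f 0" for f :: "complex \<Rightarrow> complex"
    using that by (simp add: isCont_def tendsto_nhds_iff)
  have "isCont r' 0"
    unfolding r'_def by (intro continuous_intros v_sq)
  then have "((\<lambda>z. Re (r' z)) \<longlongrightarrow> Re (r' 0)) (nhds 0)" by (intro tendsto_Re nhds)
  then have ev_r': "\<forall>\<^sub>F z in nhds 0. Re (r' z) > 0"
    by (rule order_tendstoD) (simp add: r'_def v0)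
  have "((\<lambda>z. Re (v (z\<^sup>2))) \<longlongrightarrow> Re (v (0\<^sup>2))) (nhds 0)" by (intro tendsto_Re nhds v_sq)
  then have ev_v: "\<forall>\<^sub>F z in nhds 0. Re (v (z\<^sup>2)) > 1 / 2"
    by (rule order_tendstoD) (simp add: v0)
  have "isCont h 0"
    unfolding h_def by (intro continuous_intros e_sq)
  then have "((\<lambda>z. norm (h z)) \<longlongrightarrow> norm (h 0)) (nhds 0)" by (intro tendsto_norm nhds)
  then have ev_h: "\<forall>\<^sub>F z in nhds 0. norm (h z) < norm (h 0) + 1"
    by (rule order_tendstoD) simp
  have evs: "\<forall>\<^sub>F z in nhds 0. z\<^sup>2 \<in> A" "\<forall>\<^sub>F z in nhds 0. z\<^sup>2 \<in> B"
    using A B by (auto intro!: ev_sq eventually_nhds_in_open)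
  have "\<forall>\<^sub>F z in nhds 0. z\<^sup>2 \<in> A \<and> z\<^sup>2 \<in> B \<and> norm (h z) < norm (h 0) + 1 \<and> Re (v (z\<^sup>2)) > 1 / 2 \<and> Re (r' z) > 0
     \<and> (\<Sum>k<K. \<beta> k * ((z\<^sup>2) ^ k * v (z\<^sup>2) ^ (2 * k + 1))) + (z\<^sup>2) ^ K * e (z\<^sup>2) = 1
     \<and> exp (- (z\<^sup>2 * v (z\<^sup>2) ^ 2) / 6) = eval_fps sinc_sqrt_fps (z\<^sup>2)
     \<and> (\<forall>t::real. z\<^sup>2 = of_real (t\<^sup>2) \<longrightarrow> v (z\<^sup>2) \<in> \<real>)"
    by (intro eventually_conj evs ev_h ev_v ev_r' ev_sq [OF ev_id] ev_sq [OF ev_exp] ev_sq [OF ev_real])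
  then obtain \<delta> where \<delta>: "\<delta> > 0" and P:
    "\<And>z. z \<in> ball 0 \<delta> \<Longrightarrow> z\<^sup>2 \<in> A"
    "\<And>z. z \<in> ball 0 \<delta> \<Longrightarrow> z\<^sup>2 \<in> B"
    "\<And>z. z \<in> ball 0 \<delta> \<Longrightarrow> norm (h z) < norm (h 0) + 1"
    "\<And>z. z \<in> ball 0 \<delta> \<Longrightarrow> Re (v (z\<^sup>2)) > 1 / 2"
    "\<And>z. z \<in> ball 0 \<delta> \<Longrightarrow> Re (r' z) > 0"
    "\<And>z. z \<in> ball 0 \<delta> \<Longrightarrow> (\<Sum>k<K. \<beta> k * ((z\<^sup>2) ^ k * v (z\<^sup>2) ^ (2 * k + 1))) + (z\<^sup>2) ^ K * e (z\<^sup>2) = 1"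
    "\<And>z. z \<in> ball 0 \<delta> \<Longrightarrow> exp (- (z\<^sup>2 * v (z\<^sup>2) ^ 2) / 6) = eval_fps sinc_sqrt_fps (z\<^sup>2)"
    "\<And>z t. z \<in> ball 0 \<delta> \<Longrightarrow> z\<^sup>2 = of_real (t\<^sup>2) \<Longrightarrow> v (z\<^sup>2) \<in> \<real>"
    unfolding eventually_nhds_metric by (auto simp: dist_commute)
  have dv: "((\<lambda>z. v (z\<^sup>2)) has_field_derivative deriv v (z\<^sup>2) * (2 * z)) (at z)" if "z \<in> ball 0 \<delta>" for z
    by (rule DERIV_chain2 [where f = v and g = "\<lambda>z. z\<^sup>2" and x = z, OF holomorphic_derivI [OF A(3,1) P(1) [OF that]]])
       (auto intro!: derivative_eq_intros)
  have de: "((\<lambda>z. e (z\<^sup>2)) has_field_derivative deriv e (z\<^sup>2) * (2 * z)) (at z)" if "z \<in> ball 0 \<delta>" for z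
    by (rule DERIV_chain2 [where f = e and g = "\<lambda>z. z\<^sup>2" and x = z, OF holomorphic_derivI [OF B(3,1) P(2) [OF that]]])
       (auto intro!: derivative_eq_intros)
  have dr: "(r has_field_derivative r' z) (at z)" if "z \<in> ball 0 \<delta>" for z
    unfolding r_def r'_def
    by (auto intro!: derivative_eq_intros dv [OF that])
  \<comment> \<open>Both sides are derivatives at z of one function, which is written once through
    \<open>r\<close> and once, on the ball, as z^(2K+1) e(z^2).\<close>
  have rem: "1 - (\<Sum>k<K. \<beta> k * (of_nat (2 * k + 1) * r z ^ (2 * k) * r' z)) = z ^ (2 * K) * h z"
    if z: "z \<in> ball 0 \<delta>" for z
  proof (rule DERIV_unique)
    let ?f = "\<lambda>z. z - (\<Sum>k<K. \<beta> k * r z ^ (2 * k + 1))"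
    show "(?f has_field_derivative 1 - (\<Sum>k<K. \<beta> k * (of_nat (2 * k + 1) * r z ^ (2 * k) * r' z))) (at z)"
    proof (intro DERIV_diff DERIV_ident DERIV_sum)
      show "((\<lambda>z. \<beta> k * r z ^ (2 * k + 1)) has_field_derivative
          \<beta> k * (of_nat (2 * k + 1) * r z ^ (2 * k) * r' z)) (at z)" for k
        using DERIV_cmult [OF DERIV_power [OF dr [OF z], of "2 * k + 1"], of "\<beta> k"]
        by (simp add: mult_ac del: of_nat_Suc power_Suc of_nat_add)
    qed
    have "((\<lambda>z. z ^ (2 * K + 1) * e (z\<^sup>2)) has_field_derivative z ^ (2 * K) * h z) (at z)"
      unfolding h_def
      using DERIV_mult [OF DERIV_power [OF DERIV_ident, of "2 * K + 1"] de [OF z]]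
      by (simp add: algebra_simps)
    moreover have "z ^ (2 * K + 1) * e (z\<^sup>2) = ?f z" if "z \<in> ball 0 \<delta>" for z
    proof -
      have "\<beta> k * r z ^ (2 * k + 1) = z * (\<beta> k * ((z\<^sup>2) ^ k * v (z\<^sup>2) ^ (2 * k + 1)))" for k
        unfolding r_def power_mult_distrib power_add power_mult by simp
      then have "?f z = z * (1 - (\<Sum>k<K. \<beta> k * ((z\<^sup>2) ^ k * v (z\<^sup>2) ^ (2 * k + 1))))"
        by (simp only: sum_distrib_left right_diff_distrib mult_1_right)
      also have "\<dots> = z * ((z\<^sup>2) ^ K * e (z\<^sup>2))"
        by (simp only: P(6) [OF that, symmetric] add_diff_cancel_left')
      finally show ?thesis by (simp add: power_mult)
    qed
    ultimately show "(?f has_field_derivative z ^ (2 * K) * h z) (at z)"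
      by (rule has_field_derivative_transform_within_open [OF _ open_ball z])
  qed
  \<comment> \<open>Halving the radius puts the closed interval inside the open ball.\<close>
  define d where "d = \<delta> / 2"
  have in_ball: "complex_of_real t \<in> ball 0 \<delta>" if "t \<in> {0..d}" for t
    using that \<delta> by (auto simp: d_def)
  define \<rho> where "\<rho> = (\<lambda>t. Re (r (of_real t)))"
  define \<rho>' where "\<rho>' = (\<lambda>t. Re (r' (of_real t)))"
  define b where "b = (\<lambda>k. Re (\<beta> k))"
  have v_real: "v (of_real t ^ 2) \<in> \<real>" if "complex_of_real t \<in> ball 0 \<delta>" for t
    using that by (rule P(8) [where t = t]) simp
  have r_real: "r (of_real t) \<in> \<real>" if "complex_of_real t \<in> ball 0 \<delta>" for t
    using v_real [OF that] unfolding r_def by (intro Reals_mult) auto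
  have dvec: "((\<lambda>x. r (of_real x)) has_vector_derivative r' (of_real t)) (at t)" if "t \<in> {0..d}" for t
    by (rule has_vector_derivative_real_field [OF dr [OF in_ball [OF that]]])
  have d\<rho>: "(\<rho> has_real_derivative \<rho>' t) (at t)" if "t \<in> {0..d}" for t
    unfolding \<rho>_def \<rho>'_def by (rule has_field_derivative_Re [OF dvec [OF that]])
  have r'_real: "r' (of_real t) = of_real (\<rho>' t)" if t: "t \<in> {0..d}" for t
  \<comment> \<open>The imaginary part of \<open>r\<close> vanishes on a whole real neighbourhood of
    t, so its derivative does too.\<close>
  proof -
    have "((\<lambda>x. Im (r (of_real x))) has_real_derivative Im (r' (of_real t))) (at t)"
      by (rule has_field_derivative_Im [OF dvec [OF t]])
    moreover have "((\<lambda>x. Im (r (of_real x))) has_real_derivative 0) (at t)"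
    proof (rule has_field_derivative_transform_within_open [OF DERIV_const [of 0]])
      show "open (ball 0 \<delta> :: real set)" "t \<in> ball 0 \<delta>" using in_ball [OF t] by auto
      show "0 = Im (r (of_real x))" if "x \<in> ball 0 \<delta>" for x
        using r_real [of x] that by (auto simp: complex_is_Real_iff)
    qed
    ultimately have "Im (r' (of_real t)) = 0" by (rule DERIV_unique)
    then show ?thesis by (simp add: complex_eq_iff \<rho>'_def)
  qed
  have r\<rho>: "r (of_real t) = of_real (\<rho> t)" if "t \<in> {0..d}" for t
    using r_real [OF in_ball [OF that]] by (auto simp: \<rho>_def elim: Reals_cases)
  show ?thesis
  proof (rule that [of d \<rho> \<rho>' b "norm (h 0) + 1"])
    show "d > 0" using \<delta> by (simp add: d_def)
    show "\<rho> 0 = 0" by (simp add: \<rho>_def r_def)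
    show "(\<rho> has_real_derivative \<rho>' t) (at t)" if "t \<in> {0..d}" for t
      using that by (rule d\<rho>)
    show "continuous_on {0..d} \<rho>'"
      unfolding \<rho>'_def r'_def
      by (intro continuous_intros continuous_on_compose2 [OF contv(1)] continuous_on_compose2 [OF contv(2)])
         (use P(1) in_ball in auto)
    show "\<rho>' t \<ge> 0" if "t \<in> {0..d}" for t
      using P(5) [OF in_ball [OF that]] by (simp add: \<rho>'_def)
    show "t / 2 \<le> \<rho> t" if "t \<in> {0..d}" for t
    proof -
      have "t * (1 / 2) \<le> t * Re (v (of_real t ^ 2))"
        using P(4) [OF in_ball [OF that]] that by (intro mult_left_mono) auto
      then show ?thesis by (simp add: \<rho>_def r_def)
    qed
    show "\<bar>1 - (\<Sum>k<K. b k * (real (2 * k + 1) * \<rho> t ^ (2 * k) * \<rho>' t))\<bar> \<le> (norm (h 0) + 1) * t ^ (2 * K)"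
      if t: "t \<in> {0..d}" for t
    proof -
      have *: "Re (\<beta> k * (of_nat (2 * k + 1) * r (of_real t) ^ (2 * k) * r' (of_real t)))
          = b k * (real (2 * k + 1) * \<rho> t ^ (2 * k) * \<rho>' t)" for k
      proof -
        have "of_nat (2 * k + 1) * r (of_real t) ^ (2 * k) * r' (of_real t) = of_real (real (2 * k + 1) * \<rho> t ^ (2 * k) * \<rho>' t)"
          by (simp only: r\<rho> [OF t] r'_real [OF t] of_real_mult of_real_power of_real_of_nat_eq)
        then show ?thesis by (simp only: b_def) simp
      qed
      have "1 - (\<Sum>k<K. b k * (real (2 * k + 1) * \<rho> t ^ (2 * k) * \<rho>' t))
          = Re (1 - (\<Sum>k<K. \<beta> k * (of_nat (2 * k + 1) * r (of_real t) ^ (2 * k) * r' (of_real t))))"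
        by (simp only: minus_complex.sel one_complex.sel Re_sum *)
      also have "\<dots> = Re (of_real t ^ (2 * K) * h (of_real t))"
        by (simp only: rem [OF in_ball [OF t]])
      also have "\<bar>\<dots>\<bar> \<le> norm (of_real t ^ (2 * K) * h (of_real t))"
        by (rule abs_Re_le_cmod)
      also have "\<dots> = norm (h (of_real t)) * t ^ (2 * K)"
        using t by (simp add: norm_mult norm_power)
      also have "\<dots> \<le> (norm (h 0) + 1) * t ^ (2 * K)"
        using P(3) [OF in_ball [OF t]] t by (intro mult_right_mono) auto
      finally show ?thesis .
    qed
    show "sinc t = exp (- (\<rho> t)\<^sup>2 / 6)" if t: "t \<in> {0..d}" for t
    proof -
      have "complex_of_real (sinc t) = eval_fps sinc_sqrt_fps (of_real t ^ 2)"
        by (simp only: eval_sinc_sqrt_fps of_real_power [symmetric])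
      also have "\<dots> = exp (- (r (of_real t) ^ 2) / 6)"
        unfolding P(7) [OF in_ball [OF t], symmetric] r_def by (simp add: power_mult_distrib)
      also have "\<dots> = of_real (exp (- (\<rho> t)\<^sup>2 / 6))"
        unfolding r\<rho> [OF t] by (simp flip: exp_of_real)
      finally show ?thesis by (simp only: of_real_eq_iff)
    qed
    \<comment> \<open>The last value is 3 * (1/60)^2 - (1/945 - 1/7200).\<close>
    show "b 0 = 1" "b 1 = - 1 / 60" "b 2 = - 13 / 151200"
      unfolding b_def \<beta>_def reversion_remainder_0 [OF V(2)] V(3,4) by (simp_all add: power2_eq_square)
  qed
qed

section \<open>The tail and the expansion\<close>

text \<open>Up to 1, halving the angle gives sin t <= t cos(t/2) < t; beyond 1, |sin t| <= 1 <
  t.\<close>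

lemma abs_sinc_less_1:
  assumes "t > 0"
  shows "\<bar>sinc t\<bar> < 1"
proof -
  have "\<bar>sin t\<bar> < t"
  proof (cases "t \<le> 1")
    case True
    have "sin t = 2 * sin (t / 2) * cos (t / 2)" using sin_double [of "t / 2"] by simp
    also have "\<dots> \<le> t * cos (t / 2)"
      using sin_x_le_x [of "t / 2"] assms True pi_gt3 cos_gt_zero [of "t / 2"] by (intro mult_right_mono) auto
    also have "\<dots> < t"
      using cos_monotone_0_pi [of 0 "t / 2"] assms True pi_gt3 by simp
    finally have "sin t < t" .
    moreover have "sin t > 0" using assms True pi_gt3 by (intro sin_gt_zero) auto
    ultimately show ?thesis by simp
  next
    case False
    then show ?thesis using abs_sin_le_one [of t] by linarith
  qed
  then show ?thesis using assms by (simp add: abs_divide)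
qed

text \<open>On the compact interval [d, d+2] the maximum is attained at a positive point and is
  below 1; further out |sinc t| <= 1/t <= 1/2. The maximum with 1/2 also keeps \<open>q\<close>
  positive.\<close>

lemma abs_sinc_bounded_away_from_1:
  assumes "d > 0"
  obtains q :: real where "0 < q" "q < 1" "\<And>t. t > d \<Longrightarrow> \<bar>sinc t\<bar> \<le> q"
proof -
  have "continuous_on {d..d + 2} (\<lambda>t. \<bar>sinc t\<bar>)"
    by (intro continuous_on_rabs continuous_on_sinc continuous_on_id)
  from continuous_attains_sup [OF compact_Icc _ this] obtain x where
    x: "x \<in> {d..d + 2}" "\<And>t. t \<in> {d..d + 2} \<Longrightarrow> \<bar>sinc t\<bar> \<le> \<bar>sinc x\<bar>" by auto
  have far: "\<bar>sinc t\<bar> \<le> 1 / 2" if "t > d + 2" for t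
  proof -
    have "\<bar>sin t\<bar> / t \<le> 1 / 2" using that assms by (intro frac_le) auto
    then show ?thesis using that assms by (simp add: abs_divide)
  qed
  show ?thesis
  proof (rule that [of "max (1 / 2) \<bar>sinc x\<bar>"])
    show "max (1 / 2) \<bar>sinc x\<bar> < 1" using x(1) assms abs_sinc_less_1 [of x] by auto
    show "\<bar>sinc t\<bar> \<le> max (1 / 2) \<bar>sinc x\<bar>" if "t > d" for t
    proof (cases "t \<le> d + 2")
      case True
      then show ?thesis using x(2) [of t] that by (intro max.coboundedI2) auto
    next
      case False
      then show ?thesis using far [of t] by (intro max.coboundedI1) auto
    qed
  qed auto
qed

lemma sinc_square_set_integrable:
  assumes "d > 0"
  shows "set_integrable lborel {d<..} (\<lambda>t. \<bar>sinc t\<bar> ^ 2)"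
proof (rule set_integrable_bound)
  have "set_integrable lborel UNIV (\<lambda>x::real. inverse (1 + x\<^sup>2))"
    using integrable_inverse_1_plus_square by simp
  then have "set_integrable lborel {d<..} (\<lambda>x::real. inverse (1 + x\<^sup>2))"
    by (rule set_integrable_subset) auto
  then show "set_integrable lborel {d<..} (\<lambda>x::real. (1 + 1 / d\<^sup>2) * inverse (1 + x\<^sup>2))"
    by (rule set_integrable_mult_right)
  show "set_borel_measurable lborel {d<..} (\<lambda>t. \<bar>sinc t\<bar> ^ 2)"
    unfolding set_borel_measurable_def by measurable
  \<comment> \<open>The constant comes from 1 + t^2 <= t^2 (1 + 1/d^2), valid for t > d.\<close>
  have "\<bar>sinc t\<bar> ^ 2 \<le> (1 + 1 / d\<^sup>2) * inverse (1 + t\<^sup>2)" if "t > d" for t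
  proof -
    have "d\<^sup>2 \<le> t\<^sup>2" using that assms by (intro power_mono) auto
    then have "1 + t\<^sup>2 \<le> t\<^sup>2 * (1 + 1 / d\<^sup>2)" using assms by (simp add: field_simps)
    then have *: "1 / t\<^sup>2 \<le> (1 + 1 / d\<^sup>2) * inverse (1 + t\<^sup>2)"
      using that assms by (simp add: divide_simps add_pos_nonneg mult_ac split: if_splits)
    have "(sin t)\<^sup>2 / t\<^sup>2 \<le> 1 / t\<^sup>2"
      by (intro divide_right_mono) (auto simp: abs_square_le_1)
    with * show ?thesis using that assms by (simp add: power_divide)
  qed
  then show "AE x\<in>{d<..} in lborel. norm (\<bar>sinc x\<bar> ^ 2) \<le> norm ((1 + 1 / d\<^sup>2) * inverse (1 + x\<^sup>2))"
    using assms by (intro AE_I2) (auto intro: order_trans)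
qed

text \<open>Two factors of |sinc| are kept for integrability, and the other n - 2 are each bounded
  by \<open>q\<close>; this gives geometric decay.\<close>

lemma sinc_power_tail:
  fixes q :: real
  assumes d: "d > 0" and q: "0 < q" "\<And>t. t > d \<Longrightarrow> \<bar>sinc t\<bar> \<le> q" and n: "n \<ge> 2"
  shows "set_integrable lborel {d<..} (\<lambda>t. \<bar>sinc t\<bar> ^ n)"
    and "\<bar>LBINT t:{d<..}. \<bar>sinc t\<bar> ^ n\<bar> \<le> q ^ n * ((LBINT t:{d<..}. \<bar>sinc t\<bar> ^ 2) / q\<^sup>2)"
proof -
  let ?g = "\<lambda>t. q ^ (n - 2) * \<bar>sinc t\<bar> ^ 2"
  have g: "set_integrable lborel {d<..} ?g"
    by (intro set_integrable_mult_right sinc_square_set_integrable d)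
  have le: "\<bar>sinc t\<bar> ^ n \<le> ?g t" if "t > d" for t
  proof -
    have "\<bar>sinc t\<bar> ^ n = \<bar>sinc t\<bar> ^ (n - 2) * \<bar>sinc t\<bar> ^ 2"
      using n by (metis power_add le_add_diff_inverse2)
    also have "\<dots> \<le> ?g t"
      using q(2) [OF that] by (intro mult_right_mono power_mono) auto
    finally show ?thesis .
  qed
  show int: "set_integrable lborel {d<..} (\<lambda>t. \<bar>sinc t\<bar> ^ n)"
  proof (rule set_integrable_bound [OF g])
    show "set_borel_measurable lborel {d<..} (\<lambda>t. \<bar>sinc t\<bar> ^ n)"
      unfolding set_borel_measurable_def by measurable
    show "AE t\<in>{d<..} in lborel. norm (\<bar>sinc t\<bar> ^ n) \<le> norm (?g t)"
    proof (intro AE_I2 impI)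
      fix t assume "t \<in> {d<..}"
      then have "\<bar>sinc t\<bar> ^ n \<le> \<bar>?g t\<bar>" using le [of t] by (intro order_trans [OF le abs_ge_self]) auto
      then show "norm (\<bar>sinc t\<bar> ^ n) \<le> norm (?g t)" by (simp only: real_norm_def abs_of_nonneg zero_le_power abs_ge_zero)
    qed
  qed
  have "0 \<le> (LBINT t:{d<..}. \<bar>sinc t\<bar> ^ n)"
    unfolding set_lebesgue_integral_def by (intro integral_nonneg_AE) auto
  moreover have "(LBINT t:{d<..}. \<bar>sinc t\<bar> ^ n) \<le> (LBINT t:{d<..}. ?g t)"
    using int g by (rule set_integral_mono) (use le in auto)
  moreover have "(LBINT t:{d<..}. ?g t) = q ^ (n - 2) * (LBINT t:{d<..}. \<bar>sinc t\<bar> ^ 2)"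
    by (rule set_integral_mult_right)
  moreover have "q ^ (n - 2) = q ^ n / q\<^sup>2"
    using q(1) n by (simp add: power_diff)
  ultimately show "\<bar>LBINT t:{d<..}. \<bar>sinc t\<bar> ^ n\<bar> \<le> q ^ n * ((LBINT t:{d<..}. \<bar>sinc t\<bar> ^ 2) / q\<^sup>2)"
    by simp
qed

lemma sinc_power_tail_bigo:
  assumes "d > 0"
  shows "(\<lambda>n. sqrt (real n) * (LBINT t:{d<..}. \<bar>sinc t\<bar> ^ n)) \<in> O(\<lambda>n. 1 / real n ^ K)"
proof -
  obtain q where q: "0 < q" "q < 1" "\<And>t. t > d \<Longrightarrow> \<bar>sinc t\<bar> \<le> q"
    using abs_sinc_bounded_away_from_1 [OF assms] by blast
  define c where "c = (LBINT t:{d<..}. \<bar>sinc t\<bar> ^ 2) / q\<^sup>2"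
  have "(\<lambda>n. sqrt (real n) * (LBINT t:{d<..}. \<bar>sinc t\<bar> ^ n)) \<in> O(\<lambda>n. q ^ n * sqrt (real n))"
  proof (intro bigoI [where c = c] eventually_sequentiallyI [of 2])
    fix n :: nat assume "n \<ge> 2"
    from sinc_power_tail(2) [OF assms q(1,3) this]
    have "sqrt (real n) * \<bar>LBINT t:{d<..}. \<bar>sinc t\<bar> ^ n\<bar> \<le> sqrt (real n) * (q ^ n * c)"
      unfolding c_def by (intro mult_left_mono) auto
    then show "norm (sqrt (real n) * (LBINT t:{d<..}. \<bar>sinc t\<bar> ^ n)) \<le> c * norm (q ^ n * sqrt (real n))"
      using q(1) by (simp add: abs_mult mult_ac)
  qed
  also have "(\<lambda>n. q ^ n * sqrt (real n)) \<in> O(\<lambda>n. 1 / real n ^ K)"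
    using q(1,2) by real_asymp
  finally show ?thesis .
qed

section \<open>Collecting the coefficients and the error terms\<close>

theorem theorem1:
  fixes m :: nat
  assumes "m \<ge> 3"
  shows "\<exists>c :: nat \<Rightarrow> real.
    (\<lambda>n :: nat. sinc_power_integral n -
       sqrt (3 * pi / 2) *
         (1 - 3 / 20 * (1 / real n) - 13 / 1120 * (1 / real n ^ 2)
            + (\<Sum>j = 3..m. c j / real n ^ j)))
      \<in> O(\<lambda>n. 1 / real n ^ (m + 1))"
proof -
  obtain d :: real and \<rho> \<rho>' :: "real \<Rightarrow> real" and b :: "nat \<Rightarrow> real" and C :: real where
    d: "d > 0" and \<rho>: "\<rho> 0 = 0"
    "\<And>t. t \<in> {0..d} \<Longrightarrow> (\<rho> has_real_derivative \<rho>' t) (at t)"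
    "continuous_on {0..d} \<rho>'"
    "\<And>t. t \<in> {0..d} \<Longrightarrow> \<rho>' t \<ge> 0"
    "\<And>t. t \<in> {0..d} \<Longrightarrow> t / 2 \<le> \<rho> t"
    "\<And>t. t \<in> {0..d} \<Longrightarrow>
       \<bar>1 - (\<Sum>k<m + 1. b k * (real (2 * k + 1) * \<rho> t ^ (2 * k) * \<rho>' t))\<bar> \<le> C * t ^ (2 * (m + 1))"
    and sinc: "\<And>t. t \<in> {0..d} \<Longrightarrow> sinc t = exp (- (\<rho> t)\<^sup>2 / 6)"
    and b: "b 0 = 1" "b 1 = - 1 / 60" "b 2 = - 13 / 151200"
    \<comment> \<open>With K = m + 1 the terms k = 0, ..., m are explicit and the error has order
      n^(-(m+1)).\<close>
    by (fact sinc_substitution [of "m + 1"])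
  define a where "a = (\<lambda>k. b k * real (2 * k + 1) * half_gauss_moment k * sqrt 6 ^ (2 * k + 1))"
  define s where "s = sqrt (3 * pi / 2)"
  have s: "s = sqrt pi * sqrt 6 / 2" "s > 0"
    unfolding s_def by (rule real_sqrt_unique) (simp_all add: power_mult_distrib power_divide)
  \<comment> \<open>Relative to \<open>s\<close>, the moments with their powers of 6 contribute 1, 3
    and 27; for instance 5 * 27 * (-13/151200) = -13/1120.\<close>
  have a: "a 0 = s" "a 1 = s * (- 3 / 20)" "a 2 = s * (- 13 / 1120)"
    by (simp_all add: a_def b b(2) [unfolded One_nat_def] s half_gauss_moment_def fact_numeral power_numeral_reduce)
  have expansion: "(\<Sum>k<m + 1. a k / real n ^ k)
      = s * (1 - 3 / 20 * (1 / real n) - 13 / 1120 * (1 / real n ^ 2) + (\<Sum>j = 3..m. a j / s / real n ^ j))" for n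
  proof -
    have "{..<m + 1} = insert 0 (insert 1 (insert 2 {3..m}))"
      using assms by auto
    then have "(\<Sum>k<m + 1. a k / real n ^ k) = a 0 + a 1 / n + a 2 / real n ^ 2 + (\<Sum>j = 3..m. a j / real n ^ j)"
      by simp
    also have "(\<Sum>j = 3..m. a j / real n ^ j) = s * (\<Sum>j = 3..m. a j / s / real n ^ j)"
      using s(2) by (simp add: sum_distrib_left)
    finally show ?thesis
      unfolding a by (simp add: ring_distribs)
  qed
  \<comment> \<open>The restriction to n >= 2 makes the tail integrable and is harmless for an
    asymptotic statement. On [0, d] sinc is an exponential, hence positive, so the absolute value
    disappears.\<close>
  have split: "sinc_power_integral n = sqrt (real n) * (LBINT t:{0..d}. exp (- (n / 6 * (\<rho> t)\<^sup>2)))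
      + sqrt (real n) * (LBINT t:{d<..}. \<bar>sinc t\<bar> ^ n)" if n: "n \<ge> 2" for n
  proof -
    obtain q where q: "0 < q" "\<And>t. t > d \<Longrightarrow> \<bar>sinc t\<bar> \<le> q"
      using abs_sinc_bounded_away_from_1 [OF d] by blast
    have i1: "set_integrable lborel {0..d} (\<lambda>t. \<bar>sinc t\<bar> ^ n)"
      by (intro borel_integrable_atLeastAtMost' continuous_on_power continuous_on_rabs continuous_on_sinc continuous_on_id)
    have "{0..} = {0..d} \<union> {d<..}" using d by auto
    then have "(LBINT t:{0..}. \<bar>sinc t\<bar> ^ n) = (LBINT t:{0..d}. \<bar>sinc t\<bar> ^ n) + (LBINT t:{d<..}. \<bar>sinc t\<bar> ^ n)"
      using set_integral_Un [OF _ i1 sinc_power_tail(1) [OF d q n]] by (simp only:) (simp add: disjoint_iff)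
    moreover have "(LBINT t:{0..d}. \<bar>sinc t\<bar> ^ n) = (LBINT t:{0..d}. exp (- (n / 6 * (\<rho> t)\<^sup>2)))"
    proof (rule set_lebesgue_integral_cong)
      have "\<bar>sinc t\<bar> ^ n = exp (- (n / 6 * (\<rho> t)\<^sup>2))" if "t \<in> {0..d}" for t
        unfolding sinc [OF that] by (simp flip: exp_of_nat_mult)
      then show "\<forall>t. t \<in> {0..d} \<longrightarrow> \<bar>sinc t\<bar> ^ n = exp (- (n / 6 * (\<rho> t)\<^sup>2))" by blast
    qed simp
    ultimately show ?thesis
      by (simp only: sinc_power_integral_def ring_distribs)
  qed
  have "(\<lambda>n. sqrt (real n) * (LBINT t:{0..d}. exp (- (n / 6 * (\<rho> t)\<^sup>2))) - (\<Sum>k<m + 1. a k / real n ^ k)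
      + sqrt (real n) * (LBINT t:{d<..}. \<bar>sinc t\<bar> ^ n)) \<in> O(\<lambda>n. 1 / real n ^ (m + 1))"
    unfolding a_def by (intro sum_in_bigo(1) laplace_expansion [OF d \<rho>] sinc_power_tail_bigo d)
  also have "?this \<longleftrightarrow> (\<lambda>n. sinc_power_integral n - (\<Sum>k<m + 1. a k / real n ^ k)) \<in> O(\<lambda>n. 1 / real n ^ (m + 1))"
    by (intro landau_o.big.in_cong eventually_sequentiallyI [of 2]) (simp add: split)
  finally show ?thesis
    unfolding expansion s_def by (rule exI [where x = "\<lambda>j. a j / sqrt (3 * pi / 2)"])
qed

end
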